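(* Let $n\ge 2$ and let $m_1<\cdots<m_n$ be an arithmetic sequence of positive integers, i.e. $m_i=m_1+(i-1)d$ for all $i\in\{1,\ldots,n\}$ with $d\in\mathbb{Z}^+$, and suppose $\gcd\{m_1,d\}=1$. Let $q\in\mathbb{N}$ and $r\in\{1,\ldots,n-1\}$ be such that $m_1=q(n-1)+r$, and set $\alpha:=q+d$ and $k:=n-r$. (1) If $k<n-1$, then $$\mathrm{in}(I(\mathcal{C}))=\bigcap_{i=2}^{n-1}\langle x_1^{\alpha+\delta_i},x_2,\ldots,x_{i-1},x_i^2,x_{i+1},\ldots,x_{n-1}\rangle$$ is the irredundant irreducible decomposition of $\mathrm{in}(I(\mathcal{C}))$, where $\delta_i=0$ if $i\in\{2,\ldots,k\}$ and $\delta_i=1$ if $i\in\{k+1,\ldots,n-1\}$. (2) If $k=n-1$, then $$\mathrm{in}(I(\mathcal{C}))=\left[\bigcap_{i=2}^{n-1}\langle x_1^{\alpha},x_2,\ldots,x_{i-1},x_i^2,x_{i+1},\ldots,x_{n-1}\rangle\right]\cap\langle x_1^{\alpha+1},x_2,\ldots,x_{n-1}\rangle$$ is the irredundant irreducible decomposition of $\mathrm{in}(I(\mathcal{C}))$.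
   Context: $K$ is an infinite field, $R=K[x_1,\ldots,x_{n+1}]$, and $0\in\mathbb{N}$. For positive integers $m_1<\cdots<m_n$, the associated projective monomial curve $\mathcal{C}\subset\mathbb{P}^n_K$ is parametrically defined by $x_i=u^{m_i}v^{m_n-m_i}$ for $1\le i\le n$ and $x_{n+1}=v^{m_n}$. Its vanishing ideal $I(\mathcal{C})\subset R$ is the kernel of the $K$-algebra homomorphism $R\to K[u,v]$, $x_i\mapsto u^{m_i}v^{m_n-m_i}$ ($1\le i\le n$), $x_{n+1}\mapsto v^{m_n}$. $\mathrm{in}(I(\mathcal{C}))$ denotes the initial ideal with respect to the degree reverse lexicographic order with $x_1>\cdots>x_{n+1}$. A monomial ideal is irreducible iff it is generated by pure powers of variables. The irredundant irreducible decomposition of a monomial ideal is its (unique) expression as an intersection of irreducible monomial ideals in which no ideal can be omitted. An empty intersection of ideals of $R$ is $R$. *)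

theory Defs
  imports "HOL-Algebra.RingHom" "HOL-Library.Poly_Mapping"
begin

text \<open>
  A polynomial is a finitely supported map from exponent vectors to coefficients; multiplication on
  this type is the convolution product. The ring \<open>K[x\<^sub>v | v \<in> V]\<close> is the subring of polynomials that
  only involve variables from \<open>V\<close>, packaged as a record so that ideals of HOL-Algebra are ideals
  of exactly this ring.
\<close>

type_synonym ('v, 'k) mpoly = "('v \<Rightarrow>\<^sub>0 nat) \<Rightarrow>\<^sub>0 'k"

definition mpoly_ring :: "'v set \<Rightarrow> ('v, 'k::field) mpoly ring" where
  "mpoly_ring V =
    \<lparr>carrier = {p. \<forall>t\<in>Poly_Mapping.keys p. Poly_Mapping.keys t \<subseteq> V},
     monoid.mult = (*), one = 1, zero = 0, add = (+)\<rparr>"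

definition monomial :: "('v \<Rightarrow>\<^sub>0 nat) \<Rightarrow> ('v, 'k::field) mpoly" where
  "monomial t = Poly_Mapping.single t 1"

definition var :: "'v \<Rightarrow> ('v, 'k::field) mpoly" where
  "var v = monomial (Poly_Mapping.single v 1)"

definition subst_hom ::
  "('v \<Rightarrow> ('w, 'k::field) mpoly) \<Rightarrow> ('v, 'k) mpoly \<Rightarrow> ('w, 'k) mpoly" where
  "subst_hom f p = (\<Sum>t\<in>Poly_Mapping.keys p.
     Poly_Mapping.single 0 (Poly_Mapping.lookup p t) *
     (\<Prod>v\<in>Poly_Mapping.keys t. f v ^ Poly_Mapping.lookup t v))"

lemma cring_mpoly_ring: "cring (mpoly_ring V :: ('v, 'k::field) mpoly ring)"
proof -
  let ?C = "{p :: ('v, 'k) mpoly. \<forall>t\<in>Poly_Mapping.keys p. Poly_Mapping.keys t \<subseteq> V}"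
  have add: "p + q \<in> ?C" if "p \<in> ?C" "q \<in> ?C" for p q
    using that Poly_Mapping.keys_add[of p q] by blast
  have mult: "p * q \<in> ?C" if pq: "p \<in> ?C" "q \<in> ?C" for p q
  proof -
    { fix t assume "t \<in> Poly_Mapping.keys (p * q)"
      then obtain a b where "t = a + b" "a \<in> Poly_Mapping.keys p" "b \<in> Poly_Mapping.keys q"
        using keys_mult[of p q] by blast
      then have "Poly_Mapping.keys t \<subseteq> V" using pq Poly_Mapping.keys_add[of a b] by blast }
    then show ?thesis by blast
  qed
  have neg: "- p \<in> ?C" if "p \<in> ?C" for p
    using that by simp
  let ?R = "mpoly_ring V :: ('v, 'k) mpoly ring"
  have sel: "carrier ?R = ?C" "x \<otimes>\<^bsub>?R\<^esub> y = x * y" "x \<oplus>\<^bsub>?R\<^esub> y = x + y" "\<one>\<^bsub>?R\<^esub> = 1" "\<zero>\<^bsub>?R\<^esub> = 0" for x y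
    by (simp_all add: mpoly_ring_def)
  show ?thesis
  proof (rule cringI)
    show "abelian_group ?R"
    proof (rule abelian_groupI, unfold sel)
      show "\<exists>y\<in>?C. y + x = 0" if "x \<in> ?C" for x
        using neg[OF that] by (rule rev_bexI) (rule left_minus)
    qed (fact add, simp, rule add.assoc, rule add.commute, rule add_0)
    show "comm_monoid ?R"
      by (rule comm_monoidI, unfold sel, fact mult, simp, rule mult.assoc, rule mult_1, rule mult.commute)
  qed (unfold sel, rule distrib_right)
qed

text \<open>
  Degree reverse lexicographic order on exponent vectors for \<open>x\<^sub>1 > x\<^sub>2 > \<dots>\<close>: in equal degree, at the
  largest index where two vectors differ the smaller vector has the larger exponent.
\<close>

definition total_deg :: "('v \<Rightarrow>\<^sub>0 nat) \<Rightarrow> nat" where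
  "total_deg t = (\<Sum>v\<in>Poly_Mapping.keys t. Poly_Mapping.lookup t v)"

definition drl_less :: "(nat \<Rightarrow>\<^sub>0 nat) \<Rightarrow> (nat \<Rightarrow>\<^sub>0 nat) \<Rightarrow> bool" where
  "drl_less s t \<longleftrightarrow>
     total_deg s < total_deg t \<or>
     total_deg s = total_deg t \<and>
       (\<exists>i. Poly_Mapping.lookup s i > Poly_Mapping.lookup t i \<and>
            (\<forall>j>i. Poly_Mapping.lookup s j = Poly_Mapping.lookup t j))"

definition is_initial_exponent :: "(nat, 'k::field) mpoly \<Rightarrow> (nat \<Rightarrow>\<^sub>0 nat) \<Rightarrow> bool" where
  "is_initial_exponent f t \<longleftrightarrow>
     t \<in> Poly_Mapping.keys f \<and> (\<forall>s\<in>Poly_Mapping.keys f. s \<noteq> t \<longrightarrow> drl_less s t)"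

definition initial_ideal :: "nat set \<Rightarrow> (nat, 'k::field) mpoly set \<Rightarrow> (nat, 'k) mpoly set" where
  "initial_ideal V I = Idl\<^bsub>mpoly_ring V\<^esub> {monomial t | t. \<exists>f\<in>I. is_initial_exponent f t}"

text \<open>
  The projective monomial curve. The variables of \<open>R\<close> are \<open>x\<^sub>1, \<dots>, x\<^sub>n\<^sub>+\<^sub>1\<close>; as \<open>m i \<le> m n\<close> for
  \<open>i \<le> n\<close>, the subtraction does not truncate.
\<close>

datatype param = Par_u | Par_v

definition curve_param :: "nat \<Rightarrow> (nat \<Rightarrow> nat) \<Rightarrow> nat \<Rightarrow> (param, 'k::field) mpoly" where
  "curve_param n m i =
     (if i \<le> n then var Par_u ^ m i * var Par_v ^ (m n - m i) else var Par_v ^ m n)"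

definition curve_ideal :: "nat \<Rightarrow> (nat \<Rightarrow> nat) \<Rightarrow> (nat, 'k::field) mpoly set" where
  "curve_ideal n m =
     a_kernel (mpoly_ring {1..n+1}) (mpoly_ring UNIV) (subst_hom (curve_param n m))"

definition irreducible_monomial_ideal :: "'v set \<Rightarrow> ('v, 'k::field) mpoly set \<Rightarrow> bool" where
  "irreducible_monomial_ideal V Q \<longleftrightarrow>
     (\<exists>A b. A \<subseteq> V \<and> (\<forall>v\<in>A. 1 \<le> b v) \<and> Q = Idl\<^bsub>mpoly_ring V\<^esub> {var v ^ b v | v. v \<in> A})"

text \<open>
  The components are given as a list, so that a repeated component counts as redundant. Intersecting
  with the carrier makes the empty intersection the whole ring.
\<close>

definition irredundant_irreducible_decomposition ::
  "'v set \<Rightarrow> ('v, 'k::field) mpoly set \<Rightarrow> ('v, 'k) mpoly set list \<Rightarrow> bool" where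
  "irredundant_irreducible_decomposition V I Qs \<longleftrightarrow>
     (\<forall>Q\<in>set Qs. irreducible_monomial_ideal V Q) \<and>
     I = carrier (mpoly_ring V) \<inter> (\<Inter>i<length Qs. Qs ! i) \<and>
     (\<forall>j<length Qs. I \<noteq> carrier (mpoly_ring V) \<inter> (\<Inter>i\<in>{..<length Qs} - {j}. Qs ! i))"

end

theory Submission
  imports Defs
begin

text \<open>
  The toric ideal is graded by the images of monomials, so a monomial is initial exactly when it is
  not the smallest of its fibre. The binomials \<open>x\<^sub>i x\<^sub>j - x\<^sub>i\<^sub>-\<^sub>1 x\<^sub>j\<^sub>+\<^sub>1\<close> for \<open>2 \<le> i \<le> j \<le> n - 1\<close> and
  \<open>x\<^sub>1\<^sup>\<alpha> x\<^sub>i - x\<^sub>r\<^sub>+\<^sub>i x\<^sub>n\<^sup>q x\<^sub>n\<^sub>+\<^sub>1\<^sup>d\<close> for \<open>1 \<le> i \<le> k\<close> show that the multiples of \<open>x\<^sub>i x\<^sub>j\<close> and \<open>x\<^sub>1\<^sup>\<alpha> x\<^sub>i\<close> are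
  initial. The remaining monomials are \<open>x\<^sub>1\<^sup>a x\<^sub>i\<^sup>e x\<^sub>n\<^sup>b x\<^sub>n\<^sub>+\<^sub>1\<^sup>c\<close> with \<open>e \<le> 1\<close> and \<open>a\<close> bounded, and a divisibility
  argument modulo \<open>d\<close> and \<open>n - 1\<close> shows that they lie in pairwise distinct fibres; hence none of them
  is initial. The decomposition can then be checked exponent by exponent.
\<close>

section \<open>Monomial ideals as sets of exponents\<close>

abbreviation lk :: "('a \<Rightarrow>\<^sub>0 'b::zero) \<Rightarrow> 'a \<Rightarrow> 'b" where "lk \<equiv> Poly_Mapping.lookup"
abbreviation sg :: "'a \<Rightarrow> 'b::zero \<Rightarrow> 'a \<Rightarrow>\<^sub>0 'b" where "sg \<equiv> Poly_Mapping.single"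

lemma carrier_mpoly_ring:
  "p \<in> carrier (mpoly_ring V) \<longleftrightarrow> (\<forall>t\<in>Poly_Mapping.keys p. Poly_Mapping.keys t \<subseteq> V)"
  by (simp add: mpoly_ring_def)

lemma mpoly_ring_sel [simp]:
  "x \<otimes>\<^bsub>mpoly_ring V\<^esub> y = x * y" "x \<oplus>\<^bsub>mpoly_ring V\<^esub> y = x + y"
  "\<one>\<^bsub>mpoly_ring V\<^esub> = 1" "\<zero>\<^bsub>mpoly_ring V\<^esub> = 0"
  by (simp_all add: mpoly_ring_def)

text \<open>Monomial ideals are handled through a predicate on exponents, so that inclusions and
  intersections can be checked one exponent at a time. The set becomes an ideal once
  \<open>P\<close> is closed under adding exponents.\<close>

definition exponents_ideal :: "'v set \<Rightarrow> (('v \<Rightarrow>\<^sub>0 nat) \<Rightarrow> bool) \<Rightarrow> ('v, 'k::field) mpoly set" where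
  "exponents_ideal V P = {p \<in> carrier (mpoly_ring V). \<forall>s\<in>Poly_Mapping.keys p. P s}"

lemma ideal_exponents_ideal:
  assumes "\<And>s w. P s \<Longrightarrow> P (s + w)"
  shows "ideal (exponents_ideal V P) (mpoly_ring V :: ('v, 'k::field) mpoly ring)"
proof -
  let ?R = "mpoly_ring V :: ('v, 'k) mpoly ring" and ?I = "exponents_ideal V P :: ('v, 'k) mpoly set"
  interpret R: cring ?R by (rule cring_mpoly_ring)
  have add: "p + q \<in> ?I" if "p \<in> ?I" "q \<in> ?I" for p q
    using that Poly_Mapping.keys_add[of p q]
    unfolding exponents_ideal_def carrier_mpoly_ring by blast
  have mul: "x * p \<in> ?I" if "p \<in> ?I" "x \<in> carrier ?R" for p x
  proof -
    have "x * p \<in> carrier ?R"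
      using R.m_closed[of x p] that by (simp add: exponents_ideal_def)
    moreover have "P s" if s: "s \<in> Poly_Mapping.keys (x * p)" for s
    proof -
      obtain a b where "s = a + b" "b \<in> Poly_Mapping.keys p"
        using keys_mult[of x p] s by blast
      then show ?thesis
        using assms[of b a] \<open>p \<in> ?I\<close> by (simp add: exponents_ideal_def add.commute)
    qed
    ultimately show ?thesis by (simp add: exponents_ideal_def)
  qed
  have neg: "\<ominus>\<^bsub>?R\<^esub> p \<in> ?I" if "p \<in> ?I" for p
  proof -
    have c: "p \<in> carrier ?R" "- p \<in> carrier ?R"
      using that by (auto simp: exponents_ideal_def carrier_mpoly_ring)
    then have "\<ominus>\<^bsub>?R\<^esub> p = - p"
      by (intro R.minus_equality) auto
    then show ?thesis using that c by (simp add: exponents_ideal_def)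
  qed
  show ?thesis
  proof (rule idealI)
    show "ring ?R" by (rule R.ring_axioms)
    show "subgroup ?I (add_monoid ?R)"
    proof
      show "?I \<subseteq> carrier (add_monoid ?R)" by (auto simp: exponents_ideal_def)
      show "\<one>\<^bsub>add_monoid ?R\<^esub> \<in> ?I" by (simp add: exponents_ideal_def carrier_mpoly_ring)
      show "inv\<^bsub>add_monoid ?R\<^esub> p \<in> ?I" if "p \<in> ?I" for p
        using neg[OF that] by (simp add: a_inv_def)
    qed (use add in simp)
  qed (use mul in \<open>simp_all add: mult.commute\<close>)
qed

text \<open>A polynomial is the sum of its terms, and a term whose exponent is divisible by some
  \<open>t\<close> in \<open>T\<close> is a multiple of a generator. The other inclusion is
  minimality of the generated ideal.\<close>

lemma genideal_monomials:
  assumes T: "\<And>t. t \<in> T \<Longrightarrow> Poly_Mapping.keys t \<subseteq> V"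
  shows "Idl\<^bsub>mpoly_ring V\<^esub> (monomial ` T) =
    (exponents_ideal V (\<lambda>s. \<exists>t\<in>T. \<exists>w. s = t + w) :: ('v, 'k::field) mpoly set)" (is "?L = ?E")
proof
  let ?R = "mpoly_ring V :: ('v, 'k) mpoly ring"
  interpret R: cring ?R by (rule cring_mpoly_ring)
  have sub: "monomial ` T \<subseteq> carrier ?R"
    using T by (fastforce simp: carrier_mpoly_ring monomial_def)
  have "monomial ` T \<subseteq> ?E"
  proof (rule image_subsetI)
    fix t assume t: "t \<in> T"
    then have "\<exists>t'\<in>T. \<exists>w. t = t' + w"
      by (intro bexI[OF _ t] exI[of _ 0]) simp
    then show "monomial t \<in> ?E"
      using sub t unfolding exponents_ideal_def by (auto simp: monomial_def)
  qed
  moreover have "ideal ?E ?R"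
    by (rule ideal_exponents_ideal) (metis add.assoc)
  ultimately show "?L \<subseteq> ?E" by (simp add: R.genideal_minimal)
  interpret L: ideal ?L ?R by (rule R.genideal_ideal[OF sub])
  show "?E \<subseteq> ?L"
  proof
    fix p assume p: "p \<in> ?E"
    \<comment> \<open>The induction runs over subsets of the support while \<open>p\<close> stays
      fixed, so that each term keeps its coefficient in \<open>p\<close>.\<close>
    have "(\<Sum>s\<in>S. sg s (lk p s)) \<in> ?L" if "finite S" "S \<subseteq> Poly_Mapping.keys p" for S
      using that
    proof (induction rule: finite_induct)
      case empty
      show ?case using L.zero_closed by simp
    next
      case (insert s S)
      then obtain t w where t: "t \<in> T" "s = t + w" using p by (auto simp: exponents_ideal_def)
      have "Poly_Mapping.keys s \<subseteq> V"
        using p insert.prems by (auto simp: exponents_ideal_def carrier_mpoly_ring)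
      \<comment> \<open>Exponents cannot cancel in \<open>s = t + w\<close>, so the cofactor stays
        in the ring.\<close>
      then have "Poly_Mapping.keys w \<subseteq> V"
        using t(2) by (auto simp: in_keys_iff lookup_add subset_iff)
      then have "sg w (lk p s) \<in> carrier ?R" by (auto simp: carrier_mpoly_ring)
      moreover have "monomial t \<in> ?L" using R.genideal_self[OF sub] t(1) by auto
      ultimately have "sg w (lk p s) * monomial t \<in> ?L" using L.I_l_closed by fastforce
      then have "sg s (lk p s) \<in> ?L"
        by (simp add: monomial_def mult_single t(2) add.commute)
      then show ?case using insert L.a_closed by fastforce
    qed
    moreover have "(\<Sum>s\<in>Poly_Mapping.keys p. sg s (lk p s)) = p"
      by (rule poly_mapping_eqI) (simp add: lookup_sum lookup_single when_def in_keys_iff)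
    ultimately show "p \<in> ?L" by (metis finite_keys subset_refl)
  qed
qed

section \<open>Substitution of monomials\<close>

lemma monomial_mult: "monomial s * monomial t = monomial (s + t)"
  by (simp add: monomial_def mult_single)

lemma monomial_0: "monomial 0 = 1"
  by (simp add: monomial_def)

lemma monomial_power: "monomial t ^ j = monomial (\<Sum>_<j. t)"
  by (induction j) (simp_all add: monomial_0 monomial_mult add.commute)

lemma var_power: "var v ^ j = monomial (sg v j)"
  by (induction j) (simp_all add: monomial_0 monomial_mult var_def flip: single_add)

lemma monomial_prod: "(\<Prod>v\<in>A. monomial (g v)) = monomial (\<Sum>v\<in>A. g v)"
  by (induction A rule: infinite_finite_induct) (simp_all add: monomial_0 monomial_mult)

text \<open>This is the exponent of the image of \<open>monomial t\<close> when each variable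
  \<open>v\<close> is replaced by \<open>monomial (e v)\<close>. The inner sum is a scalar multiple
  of \<open>e v\<close>.\<close>

definition pushforward :: "('v \<Rightarrow> ('w \<Rightarrow>\<^sub>0 nat)) \<Rightarrow> ('v \<Rightarrow>\<^sub>0 nat) \<Rightarrow> ('w \<Rightarrow>\<^sub>0 nat)" where
  "pushforward e t = (\<Sum>v\<in>Poly_Mapping.keys t. \<Sum>_<lk t v. e v)"

lemma lookup_pushforward:
  assumes "finite V" "Poly_Mapping.keys t \<subseteq> V"
  shows "lk (pushforward e t) w = (\<Sum>v\<in>V. lk t v * lk (e v) w)"
proof -
  have "lk (pushforward e t) w = (\<Sum>v\<in>Poly_Mapping.keys t. lk t v * lk (e v) w)"
    by (simp add: pushforward_def lookup_sum)
  also have "\<dots> = (\<Sum>v\<in>V. lk t v * lk (e v) w)"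
    using assms by (intro sum.mono_neutral_left) (auto simp: in_keys_iff)
  finally show ?thesis .
qed

lemma pushforward_add: "pushforward e (s + t) = pushforward e s + pushforward e t"
proof (rule poly_mapping_eqI)
  fix w
  let ?V = "Poly_Mapping.keys s \<union> Poly_Mapping.keys t"
  show "lk (pushforward e (s + t)) w = lk (pushforward e s + pushforward e t) w"
    using Poly_Mapping.keys_add[of s t]
    by (simp add: lookup_pushforward[of ?V] lookup_add sum.distrib distrib_right)
qed

lemma lookup_pushforward_single: "lk (pushforward e (sg v j)) w = j * lk (e v) w"
  by (subst lookup_pushforward[of "{v}"]) auto

text \<open>Terms go to terms, and those with equal \<open>pushforward e\<close> are added up, so
  the kernel can be studied fibre by fibre.\<close>

lemma subst_hom_monomials:
  "subst_hom (\<lambda>v. monomial (e v)) p =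
    (\<Sum>t\<in>Poly_Mapping.keys p. sg (pushforward e t) (lk p t))"
  unfolding subst_hom_def
  by (intro sum.cong refl)
    (simp add: monomial_power monomial_prod pushforward_def, simp add: monomial_def mult_single)

section \<open>The degree reverse lexicographic order\<close>

lemma total_deg_eq:
  assumes "finite V" "Poly_Mapping.keys t \<subseteq> V"
  shows "total_deg t = (\<Sum>v\<in>V. lk t v)"
  unfolding total_deg_def using assms
  by (intro sum.mono_neutral_left) (auto simp: in_keys_iff)

lemma total_deg_add: "total_deg (s + t) = total_deg s + total_deg t"
proof -
  let ?V = "Poly_Mapping.keys s \<union> Poly_Mapping.keys t"
  show ?thesis using Poly_Mapping.keys_add[of s t]
    by (simp add: total_deg_eq[of ?V] lookup_add sum.distrib)
qed

lemma total_deg_single: "total_deg (sg v j) = j"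
  by (simp add: total_deg_eq[of "{v}"])

lemma drl_less_irrefl: "\<not> drl_less t t"
  by (simp add: drl_less_def)

lemma drl_less_trans:
  assumes "drl_less s t" "drl_less t u" shows "drl_less s u"
proof (cases "total_deg s = total_deg t \<and> total_deg t = total_deg u")
  case True
  with assms obtain i j where
    i: "lk s i > lk t i" "\<forall>l>i. lk s l = lk t l" and j: "lk t j > lk u j" "\<forall>l>j. lk t l = lk u l"
    by (auto simp: drl_less_def)
  \<comment> \<open>The larger of the two deciding indices decides between \<open>s\<close> and
    \<open>u\<close>.\<close>
  have "lk s (max i j) > lk u (max i j) \<and> (\<forall>l>max i j. lk s l = lk u l)"
    using i j by (cases i j rule: linorder_cases) (auto simp: max_def)
  then show ?thesis using True unfolding drl_less_def by auto
next
  case False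
  with assms show ?thesis by (auto simp: drl_less_def)
qed

lemma drl_less_add: "drl_less s t \<Longrightarrow> drl_less (s + w) (t + w)"
  by (auto simp: drl_less_def total_deg_add lookup_add)

text \<open>Each entry of such an exponent is at most \<open>D\<close>. This finiteness provides the
  minimal elements used in \<open>standard_minimal\<close>.\<close>

lemma finite_bounded_degree:
  assumes "finite V"
  shows "finite {t :: 'v \<Rightarrow>\<^sub>0 nat. Poly_Mapping.keys t \<subseteq> V \<and> total_deg t = D}" (is "finite ?S")
proof -
  have "lk ` ?S \<subseteq> {f. \<forall>x. (x \<in> V \<longrightarrow> f x \<in> {..D}) \<and> (x \<notin> V \<longrightarrow> f x = 0)}"
    using assms by (auto simp: total_deg_eq[of V] in_keys_iff intro: member_le_sum)
  then have "finite (lk ` ?S)"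
    by (rule finite_subset) (use assms in \<open>intro finite_set_of_finite_funs; simp\<close>)
  then show ?thesis
    by (rule finite_imageD) (simp add: inj_on_def poly_mapping_eqI)
qed

section \<open>Initial exponents of the kernel of a monomial map\<close>

text \<open>In a kernel element the coefficients over each fibre of \<open>pushforward e\<close> add
  up to zero, so the initial exponent shares its fibre with another, smaller exponent. Conversely, a
  smaller exponent in the fibre of \<open>t\<close> gives a binomial in the kernel.\<close>

lemma initial_exponent_kernel_iff:
  fixes e :: "nat \<Rightarrow> ('w \<Rightarrow>\<^sub>0 nat)"
  assumes f: "\<And>v. v \<in> V \<Longrightarrow> f v = (monomial (e v) :: ('w, 'k::field) mpoly)"
  shows "(\<exists>p \<in> a_kernel (mpoly_ring V) (mpoly_ring UNIV) (subst_hom f). is_initial_exponent p t) \<longleftrightarrow>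
    Poly_Mapping.keys t \<subseteq> V \<and>
    (\<exists>s. Poly_Mapping.keys s \<subseteq> V \<and> pushforward e s = pushforward e t \<and> drl_less s t)"
  (is "?L \<longleftrightarrow> ?R")
proof -
  let ?h = "\<lambda>p. \<Sum>t\<in>Poly_Mapping.keys p. sg (pushforward e t) (lk p t)"
  have h: "subst_hom f p = ?h p" if "p \<in> carrier (mpoly_ring V)" for p :: "(nat, 'k) mpoly"
  proof -
    have "subst_hom f p = subst_hom (\<lambda>v. monomial (e v)) p"
      unfolding subst_hom_def using that f
      by (intro sum.cong prod.cong refl arg_cong2[where f="(*)"] arg_cong2[where f="(^)"])
        (auto simp: carrier_mpoly_ring)
    then show ?thesis by (simp add: subst_hom_monomials)
  qed
  have ker: "p \<in> a_kernel (mpoly_ring V) (mpoly_ring UNIV) (subst_hom f) \<longleftrightarrow>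
      p \<in> carrier (mpoly_ring V) \<and> ?h p = 0" for p :: "(nat, 'k) mpoly"
    using h by (auto simp: a_kernel_def')
  show ?thesis
  proof
    assume ?L
    then obtain p :: "(nat, 'k) mpoly" where p: "p \<in> carrier (mpoly_ring V)" "?h p = 0"
      "t \<in> Poly_Mapping.keys p" "\<And>s. s \<in> Poly_Mapping.keys p \<Longrightarrow> s \<noteq> t \<Longrightarrow> drl_less s t"
      unfolding is_initial_exponent_def using ker by blast
    have "\<exists>s\<in>Poly_Mapping.keys p. s \<noteq> t \<and> pushforward e s = pushforward e t"
    proof (rule ccontr)
      assume no: "\<not> ?thesis"
      \<comment> \<open>If \<open>t\<close> were alone in its fibre, its coefficient would survive
        in the image.\<close>
      have "lk (?h p) (pushforward e t) = (\<Sum>s\<in>Poly_Mapping.keys p. if s = t then lk p t else 0)"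
        unfolding lookup_sum using no by (intro sum.cong) (auto simp: lookup_single when_def)
      also have "\<dots> = lk p t" using p(3) by simp
      finally show False using p(2,3) by (simp add: in_keys_iff)
    qed
    with p show ?R by (fastforce simp: carrier_mpoly_ring)
  next
    assume R: ?R
    then obtain s where s: "Poly_Mapping.keys s \<subseteq> V" "pushforward e s = pushforward e t" "drl_less s t"
      by blast
    then have ne: "s \<noteq> t" using drl_less_irrefl by blast
    let ?p = "sg t 1 - sg s 1 :: (nat, 'k) mpoly"
    have k: "Poly_Mapping.keys ?p = {s, t}"
      using ne by (auto simp: in_keys_iff lookup_minus lookup_single when_def split: if_splits)
    have "?h ?p = 0"
      unfolding k using ne s(2) by (simp add: lookup_minus lookup_single when_def flip: single_add)
    then have "?p \<in> a_kernel (mpoly_ring V) (mpoly_ring UNIV) (subst_hom f)"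
      using R s(1) by (simp add: ker carrier_mpoly_ring k)
    moreover have "is_initial_exponent ?p t"
      using s(3) by (simp add: is_initial_exponent_def k)
    ultimately show ?L by blast
  qed
qed

section \<open>Irreducible decompositions in terms of exponents\<close>

lemma exponent_dvd_iff:
  fixes g s :: "'v \<Rightarrow>\<^sub>0 nat"
  shows "(\<exists>w. s = g + w) \<longleftrightarrow> (\<forall>v. lk g v \<le> lk s v)"
proof
  assume "\<forall>v. lk g v \<le> lk s v"
  then have "s = g + (s - g)"
    by (intro poly_mapping_eqI) (simp add: lookup_add lookup_minus)
  then show "\<exists>w. s = g + w" ..
qed (auto simp: lookup_add)

lemma genideal_var_powers:
  assumes "A \<subseteq> V"
  shows "Idl\<^bsub>mpoly_ring V\<^esub> {var v ^ b v | v. v \<in> A} =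
    (exponents_ideal V (\<lambda>s. \<exists>v\<in>A. b v \<le> lk s v) :: ('v, 'k::field) mpoly set)"
proof -
  have eq: "{var v ^ b v | v. v \<in> A} = (monomial ` (\<lambda>v. sg v (b v)) ` A :: ('v, 'k) mpoly set)"
    by (auto simp: var_power)
  have "(\<exists>w. s = sg v j + w) \<longleftrightarrow> j \<le> lk s v" for s and v :: 'v and j :: nat
    by (auto simp: exponent_dvd_iff lookup_single when_def)
  then show ?thesis
    unfolding eq using assms by (subst genideal_monomials) (auto split: if_splits)
qed

text \<open>All components share the variables \<open>A\<close> and differ only in the powers
  \<open>b\<close>. The monomial \<open>w\<close> lies in every component other than the
  \<open>j\<close>-th but not in the ideal, so the \<open>j\<close>-th component cannot be
  omitted.\<close>

lemma irredundant_decomposition_exponents: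
  fixes bs :: "('v \<Rightarrow> nat) list"
  assumes A: "A \<subseteq> V" and pos: "\<And>b v. b \<in> set bs \<Longrightarrow> v \<in> A \<Longrightarrow> 1 \<le> b v"
    and P: "\<And>s. Poly_Mapping.keys s \<subseteq> V \<Longrightarrow> P s \<longleftrightarrow> (\<forall>b\<in>set bs. \<exists>v\<in>A. b v \<le> lk s v)"
    and irr: "\<And>j. j < length bs \<Longrightarrow> \<exists>w. Poly_Mapping.keys w \<subseteq> V \<and> \<not> P w \<and>
      (\<forall>i<length bs. i \<noteq> j \<longrightarrow> (\<exists>v\<in>A. (bs ! i) v \<le> lk w v))"
  shows "irredundant_irreducible_decomposition V (exponents_ideal V P :: ('v, 'k::field) mpoly set)
    (map (\<lambda>b. Idl\<^bsub>mpoly_ring V\<^esub> {var v ^ b v | v. v \<in> A}) bs)"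
  unfolding irredundant_irreducible_decomposition_def
proof (intro conjI allI impI)
  show "\<forall>Q\<in>set (map (\<lambda>b. Idl\<^bsub>mpoly_ring V\<^esub> {var v ^ b v | v. v \<in> A}) bs).
      irreducible_monomial_ideal V (Q :: ('v, 'k) mpoly set)"
  proof
    fix Q :: "('v, 'k) mpoly set"
    assume "Q \<in> set (map (\<lambda>b. Idl\<^bsub>mpoly_ring V\<^esub> {var v ^ b v | v. v \<in> A}) bs)"
    then obtain b where b: "b \<in> set bs" "Q = Idl\<^bsub>mpoly_ring V\<^esub> {var v ^ b v | v. v \<in> A}"
      unfolding set_map by (elim imageE)
    show "irreducible_monomial_ideal V Q"
      unfolding irreducible_monomial_ideal_def
      by (rule exI[of _ A], rule exI[of _ b]) (use A pos b in simp)
  qed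
  let ?Q = "map (\<lambda>b. Idl\<^bsub>mpoly_ring V\<^esub> {var v ^ b v | v. v \<in> A}) bs :: ('v, 'k) mpoly set list"
  have Q: "?Q ! i = exponents_ideal V (\<lambda>s. \<exists>v\<in>A. (bs ! i) v \<le> lk s v)" if "i < length bs" for i
    using that by (simp add: genideal_var_powers[OF A])
  have P': "P s \<longleftrightarrow> (\<forall>i<length bs. \<exists>v\<in>A. (bs ! i) v \<le> lk s v)" if "Poly_Mapping.keys s \<subseteq> V" for s
    using P[OF that] by (simp add: all_set_conv_all_nth)
  \<comment> \<open>Stated for any index set \<open>J\<close>, to serve both the full intersection
    and the one without \<open>j\<close>.\<close>
  have mem: "p \<in> carrier (mpoly_ring V) \<inter> (\<Inter>i\<in>J. ?Q ! i) \<longleftrightarrow> p \<in> carrier (mpoly_ring V) \<and>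
      (\<forall>s\<in>Poly_Mapping.keys p. \<forall>i\<in>J. \<exists>v\<in>A. (bs ! i) v \<le> lk s v)" if "J \<subseteq> {..<length bs}" for J p
  proof -
    have "(\<Inter>i\<in>J. ?Q ! i) = (\<Inter>i\<in>J. exponents_ideal V (\<lambda>s. \<exists>v\<in>A. (bs ! i) v \<le> lk s v))"
      by (rule INF_cong[OF refl], rule Q) (use that in auto)
    then show ?thesis
      by (simp only: exponents_ideal_def Int_iff INT_iff mem_Collect_eq) blast
  qed
  show "exponents_ideal V P = carrier (mpoly_ring V) \<inter> (\<Inter>i<length ?Q. ?Q ! i)"
  proof (rule Set.set_eqI)
    fix p :: "('v, 'k) mpoly"
    show "p \<in> exponents_ideal V P \<longleftrightarrow> p \<in> carrier (mpoly_ring V) \<inter> (\<Inter>i<length ?Q. ?Q ! i)"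
      using P' by (subst mem) (auto simp: exponents_ideal_def carrier_mpoly_ring)
  qed
  fix j assume j: "j < length ?Q"
  then obtain w where w: "Poly_Mapping.keys w \<subseteq> V" "\<not> P w"
    "\<And>i. i < length bs \<Longrightarrow> i \<noteq> j \<Longrightarrow> \<exists>v\<in>A. (bs ! i) v \<le> lk w v"
    using irr[of j] by auto
  then have "monomial w \<in> carrier (mpoly_ring V) \<inter> (\<Inter>i\<in>{..<length ?Q} - {j}. ?Q ! i)"
    by (subst mem) (auto simp: carrier_mpoly_ring monomial_def)
  moreover have "monomial w \<notin> exponents_ideal V P"
    using w by (simp add: exponents_ideal_def monomial_def)
  ultimately show "exponents_ideal V P \<noteq> carrier (mpoly_ring V) \<inter> (\<Inter>i\<in>{..<length ?Q} - {j}. ?Q ! i)"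
    by blast
qed

section \<open>The curve and its reducing binomials\<close>

lemma eq_paramI:
  "lk a Par_u = lk b Par_u \<Longrightarrow> lk a Par_v = lk b Par_v \<Longrightarrow> a = b"
  by (rule poly_mapping_eqI) (metis param.exhaust)

locale arithmetic_curve =
  fixes n d q r :: nat and m :: "nat \<Rightarrow> nat"
  assumes n: "n \<ge> 2" and d: "d > 0"
    and m: "\<And>i. i \<in> {1..n} \<Longrightarrow> m i = m 1 + (i - 1) * d"
    and cop: "coprime (m 1) d"
    and r: "r \<in> {1..n-1}" and m1: "m 1 = q * (n - 1) + r"
begin

definition curve_exp :: "nat \<Rightarrow> (param \<Rightarrow>\<^sub>0 nat)" where
  "curve_exp i = (if i \<le> n then sg Par_u (m i) + sg Par_v (m n - m i) else sg Par_v (m n))"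

lemma curve_param_eq: "curve_param n m i = monomial (curve_exp i)"
  by (simp add: curve_param_def curve_exp_def var_power monomial_mult)

text \<open>Index \<open>0\<close> falls under \<open>i \<le> n\<close> in \<open>curve_exp\<close>
  and yields the unconstrained value \<open>m 0\<close>, although the variables start at index
  \<open>1\<close>.\<close>

lemma lookup_curve_exp:
  "lk (curve_exp i) Par_u = (if i \<in> {1..n} then m 1 + (i - 1) * d else if i = 0 then m 0 else 0)"
  "i \<in> {1..n} \<Longrightarrow> lk (curve_exp i) Par_v = (n - i) * d"
  "lk (curve_exp (n + 1)) Par_v = m 1 + (n - 1) * d"
proof -
  show "lk (curve_exp i) Par_v = (n - i) * d" if "i \<in> {1..n}"
  proof -
    have "(n - 1) * d - (i - 1) * d = (n - i) * d"
      using that by (simp flip: diff_mult_distrib)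
    then show ?thesis using n that m[OF that] m[of n]
      by (simp add: curve_exp_def lookup_add lookup_single)
  qed
qed (use n m[of n] m[of i] in \<open>auto simp: curve_exp_def lookup_add lookup_single\<close>)

text \<open>The case \<open>i = 1\<close> of the second family is the pure power
  \<open>x_1^(q + d + 1)\<close>. The bound \<open>n - r\<close> keeps the index
  \<open>r + i\<close> of the partner monomial at most \<open>n\<close>.\<close>

definition generators :: "(nat \<Rightarrow>\<^sub>0 nat) set" where
  "generators = {sg i 1 + sg j 1 | i j. 2 \<le> i \<and> i \<le> j \<and> j \<le> n - 1} \<union>
    {sg 1 (q + d) + sg i 1 | i. i \<in> {1..n - r}}"

definition nonstandard :: "(nat \<Rightarrow>\<^sub>0 nat) \<Rightarrow> bool" where
  "nonstandard s \<longleftrightarrow> (\<exists>g\<in>generators. \<exists>w. s = g + w)"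

text \<open>Writing \<open>n = p + c + 1\<close> avoids truncated subtraction, so that the fibre
  identities below become polynomial identities.\<close>

lemma curve_exp_at:
  assumes "p + c + 1 = n"
  shows "lk (curve_exp (p + 1)) Par_u = m 1 + p * d" "lk (curve_exp (p + 1)) Par_v = c * d"
proof -
  have i: "p + 1 \<in> {1..n}" "n - (p + 1) = c" "p + 1 - 1 = p" using assms by auto
  show "lk (curve_exp (p + 1)) Par_u = m 1 + p * d" "lk (curve_exp (p + 1)) Par_v = c * d"
    unfolding lookup_curve_exp(1) lookup_curve_exp(2)[OF i(1)] using i by (simp_all only: if_True)
qed

lemma curve_exp_last:
  assumes "N + 1 = n"
  shows "lk (curve_exp n) Par_u = m 1 + N * d" "lk (curve_exp n) Par_v = 0"
    "lk (curve_exp (n + 1)) Par_u = 0" "lk (curve_exp (n + 1)) Par_v = m 1 + N * d"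
  using curve_exp_at[of N 0] lookup_curve_exp(3) lookup_curve_exp(1)[of "n + 1"] assms by auto

lemma keys_generators: "g \<in> generators \<Longrightarrow> Poly_Mapping.keys g \<subseteq> {1..n+1}"
  using r by (auto simp: generators_def in_keys_iff lookup_add lookup_single when_def split: if_splits)

text \<open>The replacement has the same degree and the same image. It is smaller because it
  contains a variable, \<open>x_(j+1)\<close> or \<open>x_(n+1)\<close>, of larger index than all
  variables of \<open>g\<close>.\<close>

lemma generator_reducible:
  assumes "g \<in> generators"
  obtains s where "Poly_Mapping.keys s \<subseteq> {1..n+1}"
    "pushforward curve_exp s = pushforward curve_exp g" "drl_less s g"
  using assms unfolding generators_def
proof (elim UnE CollectE exE conjE)
  fix i j assume g: "g = sg i 1 + sg j 1" and ij: "2 \<le> i" "i \<le> j" "j \<le> n - 1"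
  \<comment> \<open>Moving both indices apart by one preserves their sum, hence the image along an
    arithmetic sequence.\<close>
  let ?s = "sg (i - 1) 1 + sg (j + 1) 1 :: nat \<Rightarrow>\<^sub>0 nat"
  obtain x where x: "i = x + 2" using ij(1) by (metis add.commute le_iff_add)
  obtain w where w: "j = x + w + 2" using ij(2) x by (metis add.assoc add.commute le_iff_add)
  have "j + 1 \<le> n" using ij n by simp
  then obtain y where y: "n = j + 1 + y" by (metis le_iff_add)
  show thesis
  proof (rule that)
    show "Poly_Mapping.keys ?s \<subseteq> {1..n+1}"
      using ij by (auto simp: in_keys_iff lookup_add lookup_single when_def split: if_splits)
    show "pushforward curve_exp ?s = pushforward curve_exp g"
      using curve_exp_at[of x "w + y + 2"] curve_exp_at[of "x + w + 2" y]
        curve_exp_at[of "x + 1" "w + y + 1"] curve_exp_at[of "x + w + 1" "y + 1"] x w y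
      by (intro eq_paramI)
        (simp_all add: g pushforward_add lookup_add lookup_pushforward_single algebra_simps)
    have "lk g (j + 1) < lk ?s (j + 1) \<and> (\<forall>l>j + 1. lk ?s l = lk g l)"
      using ij by (auto simp: g lookup_add lookup_single when_def)
    then show "drl_less ?s g"
      unfolding drl_less_def by (auto simp: g total_deg_add total_deg_single)
  qed
next
  fix i assume g: "g = sg 1 (q + d) + sg i 1" and i: "i \<in> {1..n - r}"
  \<comment> \<open>The factor \<open>x_1^d\<close> contributes
    \<open>d * m 1 = d * (q * (n - 1) + r)\<close> to the exponent of \<open>Par_u\<close>. This
    pays for raising \<open>q\<close> factors \<open>x_1\<close> to \<open>x_n\<close> and
    \<open>x_i\<close> to \<open>x_(r+i)\<close>, and leaves \<open>d\<close> factors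
    \<open>x_(n+1)\<close>.\<close>
  let ?s = "sg (r + i) 1 + sg n q + sg (n + 1) d :: nat \<Rightarrow>\<^sub>0 nat"
  have "r + i \<le> n" using i by auto
  then obtain c where c: "n = r + i + c" by (metis le_iff_add)
  obtain x where x: "i = x + 1" using i by (metis atLeastAtMost_iff le_iff_add add.commute)
  have M: "m 1 = q * (x + r + c) + r" using m1 c x by simp
  show thesis
  proof (rule that)
    show "Poly_Mapping.keys ?s \<subseteq> {1..n+1}"
      using i c by (auto simp: in_keys_iff lookup_add lookup_single when_def split: if_splits)
    have ri: "r + i = x + r + 1" and n': "x + r + c + 1 = n" using c x by auto
    show "pushforward curve_exp ?s = pushforward curve_exp g"
      unfolding ri g x
      using curve_exp_at[of 0 "x + r + c"] curve_exp_at[of x "r + c"] curve_exp_at[of "x + r" c]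
        curve_exp_last[OF n'] M n'
      by (intro eq_paramI)
        (simp_all add: pushforward_add lookup_add lookup_pushforward_single algebra_simps)
    have "lk g (n + 1) < lk ?s (n + 1) \<and> (\<forall>l>n + 1. lk ?s l = lk g l)"
      using i c d by (auto simp: g lookup_add lookup_single when_def)
    then show "drl_less ?s g"
      unfolding drl_less_def by (auto simp: g total_deg_add total_deg_single)
  qed
qed

section \<open>Standard monomials\<close>

lemma nonstandard_iff:
  "nonstandard s \<longleftrightarrow>
    (\<exists>i j. 2 \<le> i \<and> i \<le> j \<and> j \<le> n - 1 \<and>
      (if i = j then 1 + 1 \<le> lk s i else 1 \<le> lk s i \<and> 1 \<le> lk s j)) \<or>
    (\<exists>i\<in>{1..n-r}. if 1 = i then q + d + 1 \<le> lk s 1 else q + d \<le> lk s 1 \<and> 1 \<le> lk s i)"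
proof -
  define D where "D = (\<lambda>g. \<forall>v. lk g v \<le> lk s v)"
  have dvd: "D (sg i a + sg j 1) \<longleftrightarrow>
      (if i = j then a + 1 \<le> lk s i else a \<le> lk s i \<and> 1 \<le> lk s j)" for i j a
    by (auto simp: D_def lookup_add lookup_single when_def)
  have "nonstandard s \<longleftrightarrow> (\<exists>g\<in>generators. D g)"
    unfolding nonstandard_def exponent_dvd_iff D_def ..
  also have "\<dots> \<longleftrightarrow>
    (\<exists>i j. 2 \<le> i \<and> i \<le> j \<and> j \<le> n - 1 \<and> D (sg i 1 + sg j 1)) \<or>
    (\<exists>i\<in>{1..n-r}. D (sg 1 (q + d) + sg i 1))"
    unfolding generators_def by blast
  finally show ?thesis
    unfolding dvd .
qed

text \<open>Avoiding all \<open>x_i x_j\<close> leaves at most one of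
  \<open>x_2, ..., x_(n-1)\<close>, to the first power. The second family then bounds the exponent
  of \<open>x_1\<close> by \<open>q + d\<close>, and by \<open>q + d - 1\<close> if the middle
  variable has index at most \<open>n - r\<close>.\<close>

lemma standard_iff:
  "\<not> nonstandard s \<longleftrightarrow>
    (lk s 1 \<le> q + d \<and> (\<forall>v\<in>{2..n-1}. lk s v = 0)) \<or>
    (\<exists>i\<in>{2..n-1}. lk s 1 < q + d + of_bool (n - r < i) \<and> (\<forall>v\<in>{2..n-1}. lk s v = of_bool (v = i)))"
  (is "_ \<longleftrightarrow> ?A \<or> ?B")
proof
  assume "\<not> nonstandard s"
  then have
    A: "\<And>i j. 2 \<le> i \<Longrightarrow> i \<le> j \<Longrightarrow> j \<le> n - 1 \<Longrightarrow>
      \<not> (if i = j then 1 + 1 \<le> lk s i else 1 \<le> lk s i \<and> 1 \<le> lk s j)" and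
    B: "\<And>i. i \<in> {1..n-r} \<Longrightarrow>
      \<not> (if 1 = i then q + d + 1 \<le> lk s 1 else q + d \<le> lk s 1 \<and> 1 \<le> lk s i)"
    unfolding nonstandard_iff by blast+
  have le1: "1 \<in> {1..n-r}" using r n by auto
  have s1: "lk s 1 \<le> q + d" using B[of 1] le1 by simp
  show "?A \<or> ?B"
  proof (cases "\<forall>v\<in>{2..n-1}. lk s v = 0")
    case True
    then show ?thesis using s1 by blast
  next
    case False
    then obtain i where i: "i \<in> {2..n-1}" "1 \<le> lk s i" by auto
    have "lk s v = of_bool (v = i)" if v: "v \<in> {2..n-1}" for v
      using A[of i i] A[of i v] A[of v i] i v by (cases v i rule: linorder_cases) auto
    moreover have "lk s 1 < q + d + of_bool (n - r < i)"
      using B[of i] i s1 by (cases "n - r < i") auto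
    ultimately show ?thesis using i(1) by blast
  qed
next
  assume "?A \<or> ?B"
  then show "\<not> nonstandard s"
  proof
    have sub: "n - r \<le> n - 1" using r by auto
    show ?thesis if ?A
      unfolding nonstandard_iff
    proof (intro notI, elim disjE exE conjE bexE)
      fix x y
      assume "2 \<le> x" "x \<le> y" "y \<le> n - 1"
        "if x = y then 1 + 1 \<le> lk s x else 1 \<le> lk s x \<and> 1 \<le> lk s y"
      then show False using \<open>?A\<close> by (auto split: if_splits)
    next
      fix x
      assume "x \<in> {1..n-r}" "if 1 = x then q + d + 1 \<le> lk s 1 else q + d \<le> lk s 1 \<and> 1 \<le> lk s x"
      moreover from this sub have "x \<noteq> 1 \<Longrightarrow> lk s x = 0" using \<open>?A\<close> by simp
      ultimately show False using \<open>?A\<close> by (auto split: if_splits)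
    qed
    assume ?B
    then obtain i where i: "i \<in> {2..n-1}" "lk s 1 < q + d + of_bool (n - r < i)"
      and v: "\<And>v. 2 \<le> v \<Longrightarrow> v \<le> n - 1 \<Longrightarrow> lk s v = of_bool (v = i)" by auto
    show ?thesis
      unfolding nonstandard_iff
    proof (intro notI, elim disjE exE conjE bexE)
      fix x y
      assume "2 \<le> x" "x \<le> y" "y \<le> n - 1"
        "if x = y then 1 + 1 \<le> lk s x else 1 \<le> lk s x \<and> 1 \<le> lk s y"
      then show False using v[of x] v[of y] by (auto simp: of_bool_def split: if_splits)
    next
      fix x
      assume "x \<in> {1..n-r}" "if 1 = x then q + d + 1 \<le> lk s 1 else q + d \<le> lk s 1 \<and> 1 \<le> lk s x"
      then show False using v[of x] i(2) sub by (auto simp: of_bool_def split: if_splits)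
    qed
  qed
qed

section \<open>Standard monomials lie in distinct fibres\<close>

text \<open>The middle variable is \<open>x_(g+1)\<close>, shifted so that it contributes
  \<open>g * d\<close> beyond \<open>m 1\<close> to the exponent of \<open>Par_u\<close>;
  \<open>g = 0\<close> means that there is none.\<close>

definition standard_form :: "nat \<Rightarrow> nat \<Rightarrow> nat \<Rightarrow> nat \<Rightarrow> (nat \<Rightarrow>\<^sub>0 nat)" where
  "standard_form a g b c =
    sg 1 a + sg (g + 1) (of_bool (g > 0)) + sg n b + sg (n + 1) c"

lemma standard_formE:
  assumes "Poly_Mapping.keys t \<subseteq> {1..n+1}" "\<not> nonstandard t"
  obtains a g b c where "t = standard_form a g b c" "g \<le> n - 2"
    "g = 0 \<Longrightarrow> a \<le> q + d" "0 < g \<Longrightarrow> a + 1 \<le> q + d + of_bool (n - r \<le> g)"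
proof -
  have out: "lk t v = 0" if "v \<notin> {1..n+1}" for v
    using assms(1) that by (auto simp: in_keys_iff)
  have eq: "t = standard_form (lk t 1) g (lk t n) (lk t (n + 1))"
    if "g \<le> n - 2" "\<And>v. v \<in> {2..n-1} \<Longrightarrow> lk t v = of_bool (0 < g \<and> v = g + 1)" for g
  proof (rule poly_mapping_eqI)
    fix v
    have "v \<in> {2..n-1} \<or> v = 1 \<or> v = n \<or> v = n + 1 \<or> v \<notin> {1..n+1}" by auto
    then show "lk t v = lk (standard_form (lk t 1) g (lk t n) (lk t (n + 1))) v"
      using n that out[of v] by (elim disjE)
        (auto simp: standard_form_def lookup_add lookup_single when_def)
  qed
  from assms(2) show thesis
    unfolding standard_iff
  proof (elim disjE bexE conjE)
    assume "lk t 1 \<le> q + d" "\<forall>v\<in>{2..n-1}. lk t v = 0"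
    then show thesis using that[OF eq[of 0]] by simp
  next
    fix i assume i: "i \<in> {2..n-1}" "lk t 1 < q + d + of_bool (n - r < i)"
      "\<forall>v\<in>{2..n-1}. lk t v = of_bool (v = i)"
    \<comment> \<open>With \<open>g = i - 1\<close>, the condition \<open>n - r < i\<close> reads
      \<open>n - r \<le> g\<close>.\<close>
    have "t = standard_form (lk t 1) (i - 1) (lk t n) (lk t (n + 1))"
      using i by (intro eq) auto
    then show thesis
      by (rule that) (use i in \<open>auto simp: of_bool_def split: if_splits\<close>)
  qed
qed

text \<open>By \<open>gcd(m\<^sub>1, d) = 1\<close>, two monomials of one fibre differ by \<open>d l\<close> in the exponent of \<open>x\<^sub>n\<^sub>+\<^sub>1\<close>
  and by \<open>m\<^sub>1 l\<close> in the weight \<open>g + (n - 1) b\<close>, which forces the bound on the exponent of \<open>x\<^sub>1\<close> to fail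
  when \<open>l > 0\<close>.\<close>

lemma standard_shift_impossible:
  assumes "0 < l" "g \<le> n - 2" "g' \<le> n - 2"
    and "g' = 0 \<Longrightarrow> a' \<le> q + d" "0 < g' \<Longrightarrow> a' + 1 \<le> q + d + of_bool (n - r \<le> g')"
    and deg: "a' + of_bool (g' > 0) + b' = a + of_bool (g > 0) + b + d * l"
    and wt: "g + (n - 1) * b = g' + (n - 1) * b' + m 1 * l"
  shows False
proof -
  define N where "N = int n - 1"
  \<comment> \<open>Subtracting \<open>q * l\<close> removes the quotient part of
    \<open>m 1 = q * (n - 1) + r\<close>, so the weight equation becomes
    \<open>N * x = r * l + g' - g\<close>.\<close>
  define x where "x = int b - int b' - int q * int l"
  have N: "N \<ge> 1" "int (n - 1) = N" using n by (auto simp: N_def)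
  have gN: "int g \<le> N - 1" "int g' \<le> N - 1" using assms(2,3) n by (auto simp: N_def)
  have rN: "1 \<le> int r" "int r \<le> N" using r n by (auto simp: N_def)
  have mN: "int (m 1) = int q * N + int r" using m1 N(2) by simp
  have "int g + N * int b = int g' + N * int b' + (int q * N + int r) * int l"
    using arg_cong[OF wt, of int] N(2) unfolding mN[symmetric] by simp
  then have x: "N * x = int r * int l + int g' - int g"
    by (simp add: x_def algebra_simps)
  have l: "1 \<le> int l" using assms(1) by simp
  have grow: "int x \<le> int x * int l" for x using mult_left_mono[OF l, of "int x"] by simp
  then have rl: "int r \<le> int r * int l" .
  have ql: "int q \<le> int q * int l" "int d \<le> int d * int l" by (rule grow)+
  have deg': "int a' + of_bool (g' > 0) = int a + of_bool (g > 0) + x + int q * int l + int d * int l"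
    using arg_cong[OF deg, of int] by (simp add: x_def algebra_simps)
  have xpos: "x > 0" if "N * x > 0" using that N(1) by (simp add: zero_less_mult_iff)
  \<comment> \<open>Since \<open>r * l \<ge> 1\<close> and \<open>g \<le> N - 1\<close>, the
    right-hand side exceeds \<open>-N\<close>, and integrality gives
    \<open>x \<ge> 0\<close>.\<close>
  have "N * x > N * (- 1)" using x rl gN rN by linarith
  then have x0: "x \<ge> 0" using N(1) by (simp only: mult_less_cancel_left_pos)
  show False
  proof (cases "g' = 0")
    case g': True
    then have a': "int a' \<le> int q + int d" using assms(4) by simp
    \<comment> \<open>As \<open>l \<ge> 1\<close>, the degree equation already uses up the whole
      bound \<open>q + d\<close> on \<open>a'\<close>. What remains forces \<open>g = 0\<close> and
      \<open>x = 0\<close>, contradicting \<open>r * l > 0\<close>.\<close>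
    then have "int a + of_bool (g > 0) + x \<le> 0" using deg' ql g' by simp
    then have "g = 0" "x = 0" using x0 by (auto simp: of_bool_def split: if_splits)
    then show False using x rl rN by simp
  next
    case False
    then have a': "int a' + 1 \<le> int q + int d + of_bool (n - r \<le> g')"
      using assms(5) by (auto simp: of_bool_def split: if_splits)
    then have le: "int a + of_bool (g > 0) + x \<le> of_bool (n - r \<le> g')"
      using deg' ql False by simp
    show False
    proof (cases "n - r \<le> g'")
      case big: True
      \<comment> \<open>Here the bound on \<open>a'\<close> also allows \<open>x = 1\<close> with
        \<open>g = 0\<close>, but the large \<open>g'\<close> makes \<open>N * x\<close> at least
        \<open>N + 1 - g\<close>, which excludes it.\<close>
      then have "int g' \<ge> N + 1 - int r" using r by (auto simp: N_def)
      then have ge: "N * x \<ge> N + 1 - int g" using x rl by linarith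
      then have "N * x > 0" using gN by linarith
      then have "x \<ge> 1" using xpos by simp
      then have "g = 0" "x = 1" using le big by (auto simp: of_bool_def split: if_splits)
      then show False using ge by simp
    next
      case False
      then have "g = 0" "x = 0" using le x0 by (auto simp: of_bool_def split: if_splits)
      then show False using x rl rN by simp
    qed
  qed
qed

text \<open>Every variable maps to a monomial of degree \<open>m 1 + (n - 1) * d\<close>, so the sum
  of both exponents recovers the degree. The exponent of \<open>Par_u\<close> combines the number of
  factors other than \<open>x_(n+1)\<close> with the weight \<open>g + (n - 1) * b\<close>.\<close>

lemma lookup_pushforward_standard_form:
  assumes "g \<le> n - 2"
  shows "lk (pushforward curve_exp (standard_form a g b c)) Par_u =
      m 1 * (a + of_bool (g > 0) + b) + d * (g + (n - 1) * b)" (is ?U)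
    and "lk (pushforward curve_exp (standard_form a g b c)) Par_u +
      lk (pushforward curve_exp (standard_form a g b c)) Par_v =
      (m 1 + (n - 1) * d) * (a + of_bool (g > 0) + b + c)" (is ?UV)
proof -
  have "g + 1 + 1 \<le> n" using assms n by simp
  then obtain w where w: "n = g + 1 + 1 + w" by (metis le_iff_add)
  define N where "N = n - 1"
  have N: "N + 1 = n" "N = g + 1 + w" using w by (auto simp: N_def)
  note simps = curve_exp_at[of 0 N] curve_exp_at[of g "w + 1"] curve_exp_last[OF N(1)]
  show ?U unfolding N_def[symmetric] using simps N
    by (cases "g = 0")
      (simp_all add: standard_form_def pushforward_add lookup_add lookup_pushforward_single algebra_simps)
  show ?UV unfolding N_def[symmetric] using simps N
    by (cases "g = 0")
      (simp_all add: standard_form_def pushforward_add lookup_add lookup_pushforward_single algebra_simps)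
qed

text \<open>Equal images give equal degrees and a linear relation that coprimality turns into a
  shift by some \<open>l\<close>. Since \<open>l > 0\<close> is impossible in either direction, the
  weights agree, and they determine \<open>g\<close> and \<open>b\<close>.\<close>

lemma inj_on_standard:
  assumes s: "Poly_Mapping.keys s \<subseteq> {1..n+1}" "\<not> nonstandard s"
    and t: "Poly_Mapping.keys t \<subseteq> {1..n+1}" "\<not> nonstandard t"
    and eq: "pushforward curve_exp s = pushforward curve_exp t"
  shows "s = t"
proof -
  obtain a g b c where S: "s = standard_form a g b c" "g \<le> n - 2"
    "g = 0 \<Longrightarrow> a \<le> q + d" "0 < g \<Longrightarrow> a + 1 \<le> q + d + of_bool (n - r \<le> g)"
    using standard_formE[OF s] by metis
  obtain a' g' b' c' where T: "t = standard_form a' g' b' c'" "g' \<le> n - 2"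
    "g' = 0 \<Longrightarrow> a' \<le> q + d" "0 < g' \<Longrightarrow> a' + 1 \<le> q + d + of_bool (n - r \<le> g')"
    using standard_formE[OF t] by metis
  let ?e = "of_bool (g > 0) :: nat" and ?e' = "of_bool (g' > 0) :: nat"
  have "m 1 > 0" using m1 r by simp
  then have deg: "a + ?e + b + c = a' + ?e' + b' + c'"
    using lookup_pushforward_standard_form(2)[OF S(2), of a b c]
      lookup_pushforward_standard_form(2)[OF T(2), of a' b' c'] eq by (simp add: S(1) T(1))
  have u: "m 1 * (a + ?e + b) + d * (g + (n - 1) * b) = m 1 * (a' + ?e' + b') + d * (g' + (n - 1) * b')"
    using lookup_pushforward_standard_form(1)[OF S(2), of a b c]
      lookup_pushforward_standard_form(1)[OF T(2), of a' b' c'] eq by (simp add: S(1) T(1))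
  \<comment> \<open>Stated for arbitrary numbers, so that it applies whichever of \<open>c\<close>
    and \<open>c'\<close> is smaller.\<close>
  have shift: "\<exists>l. y = x + d * l \<and> w = v + m 1 * l"
    if "m 1 * X + d * v = m 1 * Y + d * w" "X + x = Y + y" "x \<le> y" for X Y x y v w
  proof -
    obtain z where z: "y = x + z" using \<open>x \<le> y\<close> by (metis le_iff_add)
    then have X: "X = Y + z" using that(2) by simp
    then have e: "m 1 * z + d * v = d * w" using that(1) by (simp add: distrib_left)
    then have "d dvd m 1 * z" by (metis dvd_add_left_iff dvd_triv_left)
    then have "d dvd z" using cop by (simp add: coprime_commute coprime_dvd_mult_right_iff)
    then obtain l where l: "z = d * l" ..
    have "d * (m 1 * l + v) = d * w" using e l by (simp add: algebra_simps)
    then show ?thesis using d z l by (metis add.commute mult_cancel1 less_irrefl)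
  qed
  have "c = c' \<and> g + (n - 1) * b = g' + (n - 1) * b'"
  proof (cases "c' \<le> c")
    case True
    obtain l where l: "c = c' + d * l" "g + (n - 1) * b = g' + (n - 1) * b' + m 1 * l"
      using shift[OF u[symmetric] _ True] deg by auto
    have "l = 0"
      using standard_shift_impossible[of l g g' a' b' a b] S T l deg by auto
    then show ?thesis using l by simp
  next
    case False
    then obtain l where l: "c' = c + d * l" "g' + (n - 1) * b' = g + (n - 1) * b + m 1 * l"
      using shift[OF u, of c c'] deg by auto
    have "l = 0"
      using standard_shift_impossible[of l g' g a b a' b'] S T l deg by auto
    then show ?thesis using l by simp
  qed
  then have c: "c = c'" and w: "g + (n - 1) * b = g' + (n - 1) * b'" by auto
  \<comment> \<open>By this bound, \<open>g\<close> and \<open>b\<close> are the remainder and the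
    quotient of the weight modulo \<open>n - 1\<close>.\<close>
  have lt: "g < n - 1" "g' < n - 1" using S(2) T(2) n by auto
  have "g = g'" using arg_cong[OF w, of "\<lambda>x. x mod (n - 1)"] lt by simp
  moreover have "b = b'" using arg_cong[OF w, of "\<lambda>x. x div (n - 1)"] lt by simp
  ultimately show ?thesis using deg c by (simp add: S(1) T(1))
qed

section \<open>The initial ideal of the curve\<close>

text \<open>Take a minimal \<open>u\<close> among the exponents of the fibre below \<open>t\<close>.
  If \<open>u\<close> is nonstandard, replacing a generator inside it gives a smaller one; if it is
  standard, injectivity gives \<open>u = t\<close>, although \<open>u\<close> is below
  \<open>t\<close>.\<close>

lemma standard_minimal:
  assumes t: "Poly_Mapping.keys t \<subseteq> {1..n+1}" "\<not> nonstandard t"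
    and s: "Poly_Mapping.keys s \<subseteq> {1..n+1}" "pushforward curve_exp s = pushforward curve_exp t"
  shows "\<not> drl_less s t"
proof
  assume less: "drl_less s t"
  define F where "F = {s. Poly_Mapping.keys s \<subseteq> {1..n+1} \<and>
    pushforward curve_exp s = pushforward curve_exp t \<and> drl_less s t}"
  have "F \<subseteq> (\<Union>D\<le>total_deg t. {s. Poly_Mapping.keys s \<subseteq> {1..n+1} \<and> total_deg s = D})"
    by (auto simp: F_def drl_less_def)
  then have "finite F"
    by (rule finite_subset) (intro finite_UN_I finite_bounded_degree; simp)
  moreover have "asymp_on F drl_less" "transp_on F drl_less"
    using drl_less_trans drl_less_irrefl by (auto intro!: asymp_onI transp_onI)
  moreover have "F \<noteq> {}" using s less by (auto simp: F_def)
  ultimately obtain u where u: "u \<in> F" "\<And>x. x \<in> F \<Longrightarrow> x \<noteq> u \<Longrightarrow> \<not> drl_less x u"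
    using Finite_Set.bex_min_element[of F drl_less] by blast
  show False
  proof (cases "nonstandard u")
    case True
    then obtain g w where g: "g \<in> generators" "u = g + w" by (auto simp: nonstandard_def)
    obtain g' where g': "Poly_Mapping.keys g' \<subseteq> {1..n+1}"
      "pushforward curve_exp g' = pushforward curve_exp g" "drl_less g' g"
      using generator_reducible[OF g(1)] by blast
    have "Poly_Mapping.keys w \<subseteq> {1..n+1}"
      using u(1) g(2) by (auto simp: F_def in_keys_iff lookup_add subset_iff)
    then have "Poly_Mapping.keys (g' + w) \<subseteq> {1..n+1}"
      using g'(1) Poly_Mapping.keys_add[of g' w] by blast
    moreover have less': "drl_less (g' + w) u" using drl_less_add[OF g'(3)] g(2) by simp
    moreover have "drl_less u t" using u(1) by (simp add: F_def)
    ultimately have "g' + w \<in> F"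
      using u(1) g' g(2) drl_less_trans by (auto simp: F_def pushforward_add)
    then show False using u(2) less' drl_less_irrefl by metis
  next
    case False
    then have "u = t" using inj_on_standard t u(1) by (auto simp: F_def)
    then show False using u(1) drl_less_irrefl by (auto simp: F_def)
  qed
qed

text \<open>The set \<open>E\<close> of exponents that are not smallest in their fibre contains all
  generators by \<open>generator_reducible\<close> and only nonstandard exponents by
  \<open>standard_minimal\<close>. Hence both sets have the same multiples.\<close>

lemma initial_ideal_curve:
  "initial_ideal {1..n+1} (curve_ideal n m) =
    (exponents_ideal {1..n+1} nonstandard :: (nat, 'k::field) mpoly set)"
proof -
  define E where "E = {t. Poly_Mapping.keys t \<subseteq> {1..n+1} \<and> (\<exists>s. Poly_Mapping.keys s \<subseteq> {1..n+1} \<and>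
    pushforward curve_exp s = pushforward curve_exp t \<and> drl_less s t)}"
  have "(\<exists>f \<in> (curve_ideal n m :: (nat, 'k) mpoly set). is_initial_exponent f t) \<longleftrightarrow> t \<in> E" for t
    unfolding curve_ideal_def E_def mem_Collect_eq
    by (rule initial_exponent_kernel_iff) (rule curve_param_eq)
  then have "{monomial t | t. \<exists>f \<in> (curve_ideal n m :: (nat, 'k) mpoly set). is_initial_exponent f t} =
      (monomial ` E :: (nat, 'k) mpoly set)"
    by auto
  then have "initial_ideal {1..n+1} (curve_ideal n m) =
      (exponents_ideal {1..n+1} (\<lambda>s. \<exists>t\<in>E. \<exists>w. s = t + w) :: (nat, 'k) mpoly set)"
    unfolding initial_ideal_def by (simp only:) (rule genideal_monomials, simp add: E_def)
  moreover have "(\<exists>t\<in>E. \<exists>w. s = t + w) \<longleftrightarrow> nonstandard s" for s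
  proof
    assume "\<exists>t\<in>E. \<exists>w. s = t + w"
    then obtain t w where t: "t \<in> E" "s = t + w" by blast
    then have "nonstandard t" using standard_minimal by (auto simp: E_def)
    then show "nonstandard s" using t(2) unfolding nonstandard_def by (metis add.assoc)
  next
    assume "nonstandard s"
    then obtain g w where "g \<in> generators" "s = g + w" by (auto simp: nonstandard_def)
    moreover have "g \<in> E" if g: "g \<in> generators"
    proof -
      obtain u where u: "Poly_Mapping.keys u \<subseteq> {1..n+1}"
        "pushforward curve_exp u = pushforward curve_exp g" "drl_less u g"
        using generator_reducible[OF g] by blast
      show ?thesis
        unfolding E_def mem_Collect_eq
        by (intro conjI exI[of _ u] keys_generators[OF g] u)
    qed
    ultimately show "\<exists>t\<in>E. \<exists>w. s = t + w" by blast
  qed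
  ultimately show ?thesis by simp
qed

section \<open>Comparison with the components\<close>

text \<open>The index \<open>i = 0\<close> encodes the extra component of part (2), where \<open>x\<^sub>2, \<dots>, x\<^sub>n\<^sub>-\<^sub>1\<close> all have exponent 1.\<close>

definition component_exp :: "nat \<Rightarrow> nat \<Rightarrow> nat \<Rightarrow> nat" where
  "component_exp c i v = (if v = 1 then q + d + c else if v = i then 2 else 1)"

lemma component_generators:
  assumes "i \<in> {2..n-1}"
  shows "{var 1 ^ (q + d + c), var i ^ 2} \<union> var ` ({2..n-1} - {i}) =
    {var v ^ component_exp c i v | v. v \<in> {1..n-1}}"
proof -
  have "{1..n-1} = insert 1 (insert i ({2..n-1} - {i}))" using assms by auto
  then have "{var v ^ component_exp c i v | v. v \<in> {1..n-1}} =
      (\<lambda>v. var v ^ component_exp c i v) ` insert 1 (insert i ({2..n-1} - {i}))" by blast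
  also have "\<dots> = {var 1 ^ component_exp c i 1, var i ^ component_exp c i i} \<union>
      (\<lambda>v. var v ^ component_exp c i v) ` ({2..n-1} - {i})"
    by (simp only: image_insert) blast
  also have "\<dots> = {var 1 ^ (q + d + c), var i ^ 2} \<union>
      (\<lambda>v. var v ^ component_exp c i v) ` ({2..n-1} - {i})"
    using assms by (simp only: component_exp_def) simp
  also have "(\<lambda>v. var v ^ component_exp c i v) ` ({2..n-1} - {i}) = var ` ({2..n-1} - {i})"
    by (intro image_cong) (auto simp: component_exp_def)
  finally show ?thesis ..
qed

lemma last_component_generators:
  "{var 1 ^ (q + d + c)} \<union> var ` {2..n-1} = {var v ^ component_exp c 0 v | v. v \<in> {1..n-1}}"
proof -
  have "{1..n-1} = insert 1 {2..n-1}" using n by auto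
  then have "{var v ^ component_exp c 0 v | v. v \<in> {1..n-1}} =
      (\<lambda>v. var v ^ component_exp c 0 v) ` insert 1 {2..n-1}" by blast
  also have "\<dots> = {var 1 ^ (q + d + c)} \<union> (\<lambda>v. var v ^ component_exp c 0 v) ` {2..n-1}"
    by (simp add: component_exp_def)
  also have "(\<lambda>v. var v ^ component_exp c 0 v) ` {2..n-1} = var ` {2..n-1}"
    by (intro image_cong) (auto simp: component_exp_def)
  finally show ?thesis ..
qed

text \<open>Complements are the natural side for comparison with \<open>standard_iff\<close>. For
  \<open>i = 0\<close> the bound \<open>of_bool (v = i)\<close> vanishes on \<open>{2..n-1}\<close>,
  which covers the extra component.\<close>

lemma not_in_component_iff:
  "\<not> (\<exists>v\<in>{1..n-1}. component_exp c i v \<le> lk s v) \<longleftrightarrow>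
    lk s 1 < q + d + c \<and> (\<forall>v\<in>{2..n-1}. lk s v \<le> of_bool (v = i))"
proof -
  have e: "{1..n-1} = insert 1 {2..n-1}" using n by auto
  have "component_exp c i v \<le> lk s v \<longleftrightarrow> \<not> lk s v \<le> of_bool (v = i)" if "v \<in> {2..n-1}" for v
    using that by (auto simp: component_exp_def)
  moreover have "component_exp c i 1 = q + d + c" by (simp add: component_exp_def)
  ultimately have "\<not> (\<exists>v\<in>{2..n-1}. component_exp c i v \<le> lk s v) \<longleftrightarrow>
      (\<forall>v\<in>{2..n-1}. lk s v \<le> of_bool (v = i))"
    "\<not> component_exp c i 1 \<le> lk s 1 \<longleftrightarrow> lk s 1 < q + d + c"
    by (blast, simp only: not_le)
  then show ?thesis unfolding e by blast
qed

text \<open>The complements of the components together make up the standard exponents. Each contains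
  exponents with and without \<open>x_i\<close>, which belong to different alternatives of
  \<open>standard_iff\<close>.\<close>

lemma nonstandard_iff_components:
  assumes k: "n - r < n - 1" and \<delta>: "\<And>i. i \<in> {2..n-1} \<Longrightarrow> \<delta> i = of_bool (n - r < i)"
  shows "nonstandard s \<longleftrightarrow>
    (\<forall>i\<in>{2..n-1}. \<exists>v\<in>{1..n-1}. component_exp (\<delta> i) i v \<le> lk s v)"
proof -
  have "\<not> nonstandard s \<longleftrightarrow>
      (\<exists>i\<in>{2..n-1}. lk s 1 < q + d + \<delta> i \<and> (\<forall>v\<in>{2..n-1}. lk s v \<le> of_bool (v = i)))"
    (is "_ \<longleftrightarrow> ?R")
  proof
    assume "\<not> nonstandard s"
    then show ?R
      unfolding standard_iff
    proof (elim disjE bexE conjE)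
      assume "lk s 1 \<le> q + d" "\<forall>v\<in>{2..n-1}. lk s v = 0"
      \<comment> \<open>Without a middle variable, \<open>x_1^(q + d)\<close> may occur, so a
        component with \<open>\<delta> i = 1\<close> is needed; \<open>n - 1\<close> is such an
        index because \<open>n - r < n - 1\<close>.\<close>
      then show ?R using k r \<delta>[of "n - 1"] by (intro bexI[of _ "n - 1"]) auto
    next
      fix i assume "i \<in> {2..n-1}" "lk s 1 < q + d + of_bool (n - r < i)"
        "\<forall>v\<in>{2..n-1}. lk s v = of_bool (v = i)"
      then show ?R using \<delta> by (intro bexI[of _ i]) auto
    qed
  next
    assume ?R
    then obtain i where i: "i \<in> {2..n-1}" "lk s 1 < q + d + of_bool (n - r < i)"
      "\<And>v. v \<in> {2..n-1} \<Longrightarrow> lk s v \<le> of_bool (v = i)" using \<delta> by auto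
    show "\<not> nonstandard s"
    proof (cases "lk s i = 0")
      case True
      then have "lk s v = 0" if "v \<in> {2..n-1}" for v using i(3)[OF that] by (cases "v = i") auto
      moreover have "lk s 1 \<le> q + d" using i(2) by (auto simp: of_bool_def split: if_splits)
      ultimately show ?thesis unfolding standard_iff by blast
    next
      case False
      then have "lk s v = of_bool (v = i)" if "v \<in> {2..n-1}" for v
        using i(3)[OF that] by (cases "v = i") auto
      then show ?thesis unfolding standard_iff using i(1,2) by blast
    qed
  qed
  then show ?thesis unfolding not_in_component_iff[symmetric] by blast
qed

text \<open>Here \<open>r = 1\<close>, so no middle index exceeds \<open>n - r\<close>, and the
  standard exponents with \<open>x_1\<close>-exponent exactly \<open>q + d\<close> lie outside the
  extra component only.\<close>

lemma nonstandard_iff_components_last: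
  assumes k: "n - r = n - 1"
  shows "nonstandard s \<longleftrightarrow>
    (\<forall>i\<in>{2..n-1}. \<exists>v\<in>{1..n-1}. component_exp 0 i v \<le> lk s v) \<and>
    (\<exists>v\<in>{1..n-1}. component_exp 1 0 v \<le> lk s v)"
proof -
  have "\<not> nonstandard s \<longleftrightarrow>
      (\<exists>i\<in>{2..n-1}. lk s 1 < q + d + 0 \<and> (\<forall>v\<in>{2..n-1}. lk s v \<le> of_bool (v = i))) \<or>
      (lk s 1 < q + d + 1 \<and> (\<forall>v\<in>{2..n-1}. lk s v \<le> of_bool (v = 0)))"
    (is "_ \<longleftrightarrow> ?R \<or> ?S")
  proof
    assume "\<not> nonstandard s"
    then show "?R \<or> ?S"
      unfolding standard_iff
    proof (elim disjE bexE conjE)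
      fix i assume "i \<in> {2..n-1}" "lk s 1 < q + d + of_bool (n - r < i)"
        "\<forall>v\<in>{2..n-1}. lk s v = of_bool (v = i)"
      then show "?R \<or> ?S" using k by (intro disjI1 bexI[of _ i]) auto
    qed auto
  next
    have S: "\<not> nonstandard s" if "lk s 1 \<le> q + d" "\<And>v. v \<in> {2..n-1} \<Longrightarrow> lk s v = 0"
      using that unfolding standard_iff by blast
    assume "?R \<or> ?S"
    then show "\<not> nonstandard s"
    proof
      assume ?S
      then show ?thesis by (intro S) auto
    next
      assume ?R
      then obtain i where i: "i \<in> {2..n-1}" "lk s 1 < q + d"
        "\<And>v. v \<in> {2..n-1} \<Longrightarrow> lk s v \<le> of_bool (v = i)" by auto
      show ?thesis
      proof (cases "lk s i = 0")
        case True
        then have "lk s v = 0" if "v \<in> {2..n-1}" for v using i(3)[OF that] by (cases "v = i") auto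
        then show ?thesis using i(2) by (intro S) auto
      next
        case False
        then have "lk s v = of_bool (v = i)" if "v \<in> {2..n-1}" for v
          using i(3)[OF that] by (cases "v = i") auto
        then show ?thesis unfolding standard_iff using i(1,2) by (intro disjI2 bexI[of _ i]) auto
      qed
    qed
  qed
  then show ?thesis unfolding not_in_component_iff[symmetric] by blast
qed

section \<open>Irredundance and the two decompositions\<close>

text \<open>The witness is the standard monomial \<open>x_1^(q + d + c - 1) x_i\<close>. Its factor
  \<open>x_i\<close> puts it into every component with another index, where \<open>x_i\<close>
  itself is a generator.\<close>

lemma component_witness:
  fixes c :: nat
  assumes i: "i \<in> {2..n-1}" and c: "c \<le> of_bool (n - r < i)"
  obtains w where "Poly_Mapping.keys w \<subseteq> {1..n+1}" "\<not> nonstandard w"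
    "\<And>c' i'. i' \<noteq> i \<Longrightarrow> \<exists>v\<in>{1..n-1}. component_exp c' i' v \<le> lk w v"
proof (rule that)
  let ?w = "sg 1 (q + d + c - 1) + sg i 1 :: nat \<Rightarrow>\<^sub>0 nat"
  show "Poly_Mapping.keys ?w \<subseteq> {1..n+1}"
    using i by (auto simp: in_keys_iff lookup_add lookup_single when_def split: if_splits)
  have "lk ?w 1 < q + d + of_bool (n - r < i)"
    using i c d by (simp add: lookup_add lookup_single)
  moreover have "lk ?w v = of_bool (v = i)" if "v \<in> {2..n-1}" for v
    using that by (auto simp: lookup_add lookup_single when_def)
  ultimately show "\<not> nonstandard ?w"
    unfolding standard_iff using i by blast
  show "\<exists>v\<in>{1..n-1}. component_exp c' i' v \<le> lk ?w v" if "i' \<noteq> i" for c' i'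
    using i that by (intro bexI[of _ i]) (auto simp: component_exp_def lookup_add lookup_single)
qed

lemma decomposition_less:
  assumes k: "n - r < n - 1" and \<delta>: "\<And>i. i \<in> {2..n-1} \<Longrightarrow> \<delta> i = of_bool (n - r < i)"
  shows "irredundant_irreducible_decomposition {1..n+1}
    (initial_ideal {1..n+1} (curve_ideal n m) :: (nat, 'k::field) mpoly set)
    (map (\<lambda>i. Idl\<^bsub>mpoly_ring {1..n+1}\<^esub>
      ({var 1 ^ (q + d + \<delta> i), var i ^ 2} \<union> var ` ({2..n-1} - {i}))) [2..<n])"
proof -
  define bs where "bs = map (\<lambda>i. component_exp (\<delta> i) i) [2..<n]"
  have upt: "set [2..<n] = {2..n-1}" using n by auto
  have "irredundant_irreducible_decomposition {1..n+1}
    (exponents_ideal {1..n+1} nonstandard :: (nat, 'k::field) mpoly set)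
    (map (\<lambda>b. Idl\<^bsub>mpoly_ring {1..n+1}\<^esub> {var v ^ b v | v. v \<in> {1..n-1}}) bs)"
  proof (rule irredundant_decomposition_exponents)
    show "1 \<le> b v" if "b \<in> set bs" for b v
      using that d by (auto simp: bs_def component_exp_def)
    show "nonstandard s \<longleftrightarrow> (\<forall>b\<in>set bs. \<exists>v\<in>{1..n-1}. b v \<le> lk s v)" for s
      unfolding bs_def set_map upt ball_simps by (rule nonstandard_iff_components[OF k \<delta>])
    fix j assume "j < length bs"
    \<comment> \<open>The list \<open>[2..<n]\<close> starts at \<open>2\<close>, so position
      \<open>j\<close> holds the component of index \<open>j + 2\<close>.\<close>
    then have j: "j + 2 \<in> {2..n-1}" by (auto simp: bs_def)
    have nth: "bs ! i = component_exp (\<delta> (i + 2)) (i + 2)" if "i < length bs" for i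
      using that by (simp add: bs_def add.commute)
    obtain w where "Poly_Mapping.keys w \<subseteq> {1..n+1}" "\<not> nonstandard w"
      "\<And>c' i'. i' \<noteq> j + 2 \<Longrightarrow> \<exists>v\<in>{1..n-1}. component_exp c' i' v \<le> lk w v"
      using component_witness[of "j + 2" "\<delta> (j + 2)"] j \<delta> by (metis order_refl)
    then show "\<exists>w. Poly_Mapping.keys w \<subseteq> {1..n+1} \<and> \<not> nonstandard w \<and>
        (\<forall>i<length bs. i \<noteq> j \<longrightarrow> (\<exists>v\<in>{1..n-1}. (bs ! i) v \<le> lk w v))"
      using nth by (intro exI[of _ w]) simp
  qed auto
  moreover have "map (\<lambda>b. Idl\<^bsub>mpoly_ring {1..n+1}\<^esub> {var v ^ b v | v. v \<in> {1..n-1}} :: (nat, 'k) mpoly set) bs =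
      map (\<lambda>i. Idl\<^bsub>mpoly_ring {1..n+1}\<^esub>
        ({var 1 ^ (q + d + \<delta> i), var i ^ 2} \<union> var ` ({2..n-1} - {i}))) [2..<n]"
    unfolding bs_def map_map comp_def
    by (rule map_cong[OF refl]) (simp only: upt component_generators)
  ultimately show ?thesis by (simp only: initial_ideal_curve)
qed

lemma decomposition_eq:
  assumes k: "n - r = n - 1"
  shows "irredundant_irreducible_decomposition {1..n+1}
    (initial_ideal {1..n+1} (curve_ideal n m) :: (nat, 'k::field) mpoly set)
    (map (\<lambda>i. Idl\<^bsub>mpoly_ring {1..n+1}\<^esub>
      ({var 1 ^ (q + d), var i ^ 2} \<union> var ` ({2..n-1} - {i}))) [2..<n]
     @ [Idl\<^bsub>mpoly_ring {1..n+1}\<^esub> ({var 1 ^ (q + d + 1)} \<union> var ` {2..n-1})])"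
proof -
  define bs where "bs = map (\<lambda>i. component_exp 0 i) [2..<n] @ [component_exp 1 0]"
  have upt: "set [2..<n] = {2..n-1}" using n by auto
  have "irredundant_irreducible_decomposition {1..n+1}
    (exponents_ideal {1..n+1} nonstandard :: (nat, 'k::field) mpoly set)
    (map (\<lambda>b. Idl\<^bsub>mpoly_ring {1..n+1}\<^esub> {var v ^ b v | v. v \<in> {1..n-1}}) bs)"
  proof (rule irredundant_decomposition_exponents)
    show "1 \<le> b v" if "b \<in> set bs" for b v
      using that d by (auto simp: bs_def component_exp_def)
    have set_bs: "set bs = insert (component_exp 1 0) (component_exp 0 ` {2..n-1})"
      unfolding bs_def set_append set_map upt by simp
    show "nonstandard s \<longleftrightarrow> (\<forall>b\<in>set bs. \<exists>v\<in>{1..n-1}. b v \<le> lk s v)" for s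
      unfolding nonstandard_iff_components_last[OF k] set_bs
      by (simp only: ball_simps conj_commute)
    have nth: "bs ! i = (if i < n - 2 then component_exp 0 (i + 2) else component_exp 1 0)"
      if "i < length bs" for i
      using that by (auto simp: bs_def nth_append add.commute)
    fix j assume j: "j < length bs"
    show "\<exists>w. Poly_Mapping.keys w \<subseteq> {1..n+1} \<and> \<not> nonstandard w \<and>
        (\<forall>i<length bs. i \<noteq> j \<longrightarrow> (\<exists>v\<in>{1..n-1}. (bs ! i) v \<le> lk w v))"
    proof (cases "j < n - 2")
      case True
      then have "j + 2 \<in> {2..n-1}" by auto
      then obtain w where w: "Poly_Mapping.keys w \<subseteq> {1..n+1}" "\<not> nonstandard w"
        "\<And>c' i'. i' \<noteq> j + 2 \<Longrightarrow> \<exists>v\<in>{1..n-1}. component_exp c' i' v \<le> lk w v"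
        using component_witness[of "j + 2" 0] by (metis zero_le)
      have "\<exists>v\<in>{1..n-1}. (bs ! i) v \<le> lk w v" if "i < length bs" "i \<noteq> j" for i
        \<comment> \<open>The instance with index \<open>0\<close> treats the extra component at the
          end of the list.\<close>
        using nth[OF that(1)] w(3)[of "i + 2" 0] w(3)[of 0 1] that(2) by (auto split: if_splits)
      then show ?thesis using w(1,2) by blast
    next
      case False
      \<comment> \<open>For the extra component the witness is \<open>x_1^(q + d)\<close>: it is
        standard, and it is a generator of all the other components.\<close>
      let ?w = "sg 1 (q + d) :: nat \<Rightarrow>\<^sub>0 nat"
      have "Poly_Mapping.keys ?w \<subseteq> {1..n+1}" by simp
      moreover have "\<not> nonstandard ?w"
        unfolding standard_iff by (simp add: lookup_single)
      moreover have "\<exists>v\<in>{1..n-1}. (bs ! i) v \<le> lk ?w v" if "i < length bs" "i \<noteq> j" for i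
      proof (rule bexI[of _ 1])
        have "i < n - 2" using that j False by (auto simp: bs_def)
        then show "(bs ! i) 1 \<le> lk ?w 1" using nth[OF that(1)] by (simp add: component_exp_def)
      qed (use n in simp)
      ultimately show ?thesis by blast
    qed
  qed auto
  moreover have "map (\<lambda>b. Idl\<^bsub>mpoly_ring {1..n+1}\<^esub> {var v ^ b v | v. v \<in> {1..n-1}} :: (nat, 'k) mpoly set) bs =
      map (\<lambda>i. Idl\<^bsub>mpoly_ring {1..n+1}\<^esub>
        ({var 1 ^ (q + d), var i ^ 2} \<union> var ` ({2..n-1} - {i}))) [2..<n]
      @ [Idl\<^bsub>mpoly_ring {1..n+1}\<^esub> ({var 1 ^ (q + d + 1)} \<union> var ` {2..n-1})]"
    unfolding bs_def map_append map_map comp_def list.map last_component_generators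
    by (intro arg_cong2[where f = "(@)"] map_cong refl)
      (simp only: upt component_generators[where c = 0, unfolded add_0_right])
  ultimately show ?thesis by (simp only: initial_ideal_curve)
qed

end

theorem proposition2p5:
  fixes n d q r \<alpha> k :: nat and m \<delta> :: "nat \<Rightarrow> nat"
  assumes "infinite (UNIV :: 'k::field set)"
    and "n \<ge> 2"
    and "m 1 > 0" and "d > 0"
    and "\<And>i. i \<in> {1..n} \<Longrightarrow> m i = m 1 + (i - 1) * d"
    and "gcd (m 1) d = 1"
    and "r \<in> {1..n-1}"
    and "m 1 = q * (n - 1) + r"
    and "\<alpha> = q + d"
    and "k = n - r"
    and "\<And>i. i \<in> {2..k} \<Longrightarrow> \<delta> i = 0"
    and "\<And>i. i \<in> {k+1..n-1} \<Longrightarrow> \<delta> i = 1"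
  shows "(k < n - 1 \<longrightarrow>
      irredundant_irreducible_decomposition {1..n+1}
        (initial_ideal {1..n+1} (curve_ideal n m :: (nat, 'k) mpoly set))
        (map (\<lambda>i. Idl\<^bsub>mpoly_ring {1..n+1}\<^esub>
                 ({var 1 ^ (\<alpha> + \<delta> i), var i ^ 2} \<union> var ` ({2..n-1} - {i}))) [2..<n]))
    \<and> (k = n - 1 \<longrightarrow>
      irredundant_irreducible_decomposition {1..n+1}
        (initial_ideal {1..n+1} (curve_ideal n m :: (nat, 'k) mpoly set))
        (map (\<lambda>i. Idl\<^bsub>mpoly_ring {1..n+1}\<^esub>
                 ({var 1 ^ \<alpha>, var i ^ 2} \<union> var ` ({2..n-1} - {i}))) [2..<n]
         @ [Idl\<^bsub>mpoly_ring {1..n+1}\<^esub> ({var 1 ^ (\<alpha> + 1)} \<union> var ` {2..n-1})]))"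
proof -
  interpret arithmetic_curve n d q r m
    by unfold_locales (fact | rule assms(6)[folded coprime_iff_gcd_eq_1])+
  have \<delta>: "\<delta> i = of_bool (n - r < i)" if "i \<in> {2..n-1}" for i
    using that assms(10) assms(11,12)[of i] by (cases "i \<le> k") auto
  show ?thesis
    unfolding assms(9,10)
    by (intro conjI impI decomposition_less decomposition_eq \<delta>)
qed

end
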